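(* Let $\mathscr{E}=\{E_1|H_1,\ldots,E_n|H_n\}$ be a family of $n$ conditional events with $E_1,\ldots,E_n,H_1,\ldots,H_n$ logically independent. Let $\mathscr{F}=\{\mathscr{C}_S:\emptyset\neq S\subseteq\{1,\ldots,n\}\}$, where $\mathscr{C}_S=\bigwedge_{i\in S}(E_i|H_i)$, and let $\mathscr{K}=\{\mathscr{C}_{i_1\cdots i_h\overline{i_{h+1}}\cdots\overline{i_n}}:\{i_1,\ldots,i_h\}\subseteq\{1,\ldots,n\}\}$ be the set of conditional constituents associated with $\mathscr{E}$. A prevision assessment $(\mathcal{M},\mathscr{P})$ on $\mathscr{F}\cup\mathscr{K}$, with $\mathcal{M}=(x_S:\emptyset\ne S\subseteq\{1,\ldots,n\})$ on $\mathscr{F}$ and $\mathscr{P}=(x_{i_1\cdots i_h\overline{i_{h+1}}\cdots\overline{i_n}}:\{i_1,\ldots,i_h\}\subseteq\{1,\ldots,n\})$ on $\mathscr{K}$, is coherent if and only if it is associated with a vector $\mathscr{V}=(v_{\{i_1,\ldots,i_h\}}:\{i_1,\ldots,i_h\}\subseteq\{1,\ldots,n\})$ of the simplex $\Delta$, i.e. if and only if there is $\mathscr{V}\in\Delta$ such that \[ x_{i_1\cdots i_h\overline{i_{h+1}}\cdots\overline{i_n}}=v_{\{i_1,\ldots,i_h\}}\ \ \forall\,\{i_1,\ldots,i_h\}\subseteq\{1,\ldots,n\},\qquad x_S=\sum_{\{i_1,\ldots,i_h\}\supseteq S}v_{\{i_1,\ldots,i_h\}}\ \ \forall\,\emptyset\neq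 S\subseteq\{1,\ldots,n\}. \]
   Context: Events. Events are elements of a Boolean algebra with top $\Omega$ (sure event) and bottom $\emptyset$ (impossible event); one may take subsets of a set $\Omega$. An event is identified with its $0/1$ indicator; $EF$ or $E\wedge F$ is conjunction, $E\vee F$ disjunction, $\overline{E}$ negation. Events $A_1,\ldots,A_m$ are logically independent if all $2^m$ conjunctions $A_1^*\cdots A_m^*$ with $A_i^*\in\{A_i,\overline{A}_i\}$ are $\neq\emptyset$. Conditional random quantities. Given an event $H\neq\emptyset$, a random quantity $X$ (a real-valued function on $\Omega$ with finitely many values on $H$) and an assessed real number $\mu=\mathbb{P}(X|H)$ (the conditional prevision), the conditional random quantity $X|H$ is $XH+\mu\overline{H}$ (value $X$ if $H$ is true, $\mu$ if $H$ is false). For a conditional event $E|H$ with $P(E|H)=x$, its indicator (same symbol) is $E|H=EH+x\overline{H}$; it is true, false or void when $EH$, $\overline{E}H$ or $\overline{H}$ is true, respectively. Coherence. A prevision assessment on a family of conditional random quantities is coherent if for every finite subfamily $X_1|H_1,\ldots,X_m|H_m$ with assessed previsions $\mu_1,\ldots,\mu_m$ and all real $s_1,\ldots,s_m$, the random gain $G=\sum_{i=1}^m s_iH_i(X_i-\mu_i)$, restricted to $H_1\vee\cdots\vee H_m$, satisfies $\min G\le 0\le\max G$. Conjunction. For a finite family $(A_i|K_i)_{i\in T}$ of conditional events, the conjunctions $\mathscr{C}_S=\bigwedge_{i\in S}(A_i|K_i)$, $\emptyset\ne S\subseteq T$, with assessed previsions $x_S=\mathbb{P}(\mathscr{C}_S)$,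 are defined recursively on $|S|$ by \[ \mathscr{C}_S=\Big[\bigwedge_{i\in S}A_iK_i+\sum_{\emptyset\neq R\subsetneq S}x_R\Big(\bigwedge_{i\in R}\overline{K}_i\Big)\wedge\Big(\bigwedge_{i\in S\setminus R}A_iK_i\Big)\Big]\Big|\Big(\bigvee_{i\in S}K_i\Big), \] i.e. $\mathscr{C}_S$ has value $1$ if all $A_iK_i$ ($i\in S$) are true; $0$ if some $\overline{A}_iK_i$ is true; $x_R$ if exactly the conditional events with index in $R$ are void and the others are true ($\emptyset\ne R\subsetneq S$); $x_S$ if all $K_i$, $i\in S$, are false. Conditional constituents. For $\{i_1,\ldots,i_h\}\subseteq\{1,\ldots,n\}$ with complement $\{i_{h+1},\ldots,i_n\}$, the conditional constituent is $\mathscr{C}_{i_1\cdots i_h\overline{i_{h+1}}\cdots\overline{i_n}}=(E_{i_1}|H_{i_1})\wedge\cdots\wedge(E_{i_h}|H_{i_h})\wedge(\overline{E}_{i_{h+1}}|H_{i_{h+1}})\wedge\cdots\wedge(\overline{E}_{i_n}|H_{i_n})$. It is obtained from elements of $\mathscr{F}$ through the identity \[ \mathscr{C}_{i_1\cdots i_h\overline{i_{h+1}}\cdots\overline{i_n}}=\sum_{k=0}^{n-h}(-1)^k\sum_{\{j_1,\ldots,j_k\}\subseteq\{i_{h+1},\ldots,i_n\}}\mathscr{C}_{i_1\cdots i_hj_1\cdots j_k}, \] with the convention $\mathscr{C}_{\emptyset}=1$; in considering assessments on $\mathscr{F}\cup\mathscr{K}$, the constituents are understood to be the conditional random quantities (with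 conditioning event $H_1\vee\cdots\vee H_n$) given by this expression. Under logical independence there are $2^n$ conditional constituents. The conjunction $\mathscr{C}_{1\cdots n}$ belongs to both $\mathscr{F}$ and $\mathscr{K}$, so its prevision appears in both $\mathcal{M}$ and $\mathscr{P}$. Simplex. $\Delta$ is the $(2^n-1)$-dimensional simplex of $\mathbb{R}^{2^n}$: the set of vectors $\mathscr{V}=(v_{\{i_1,\ldots,i_h\}}:\{i_1,\ldots,i_h\}\subseteq\{1,\ldots,n\})$ with $v_{\{i_1,\ldots,i_h\}}\ge 0$ for all subsets (including $\emptyset$) and $\sum_{\{i_1,\ldots,i_h\}\subseteq\{1,\ldots,n\}}v_{\{i_1,\ldots,i_h\}}=1$. *)

theory Defs
  imports Complex_Main "HOL-Library.FuncSet" "HOL-Library.Indicator_Function"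
begin

text \<open>
  Events are sets over a type \<open>'a\<close>, which plays the role of the sure event. A family of events
  is logically independent if all its constituents are possible.
\<close>

definition logically_independent :: "'i set \<Rightarrow> ('i \<Rightarrow> 'a set) \<Rightarrow> bool" where
  "logically_independent J A \<longleftrightarrow>
     (\<forall>T\<subseteq>J. (\<Inter>i\<in>T. A i) \<inter> (\<Inter>i\<in>J - T. - A i) \<noteq> {})"

text \<open>
  A triple \<open>(X, H, \<mu>)\<close> stands for the conditional random quantity \<open>X|H\<close> together with its
  assessed prevision \<open>\<mu>\<close>.
\<close>

type_synonym 'a assessed = "('a \<Rightarrow> real) \<times> 'a set \<times> real"

definition cond_rq :: "('a \<Rightarrow> real) \<Rightarrow> 'a set \<Rightarrow> real \<Rightarrow> 'a \<Rightarrow> real" where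
  "cond_rq X H \<mu> \<omega> = X \<omega> * indicator H \<omega> + \<mu> * indicator (- H) \<omega>"

definition gain :: "('a assessed \<Rightarrow> real) \<Rightarrow> 'a assessed set \<Rightarrow> 'a \<Rightarrow> real" where
  "gain s \<F> \<omega> = (\<Sum>(X, H, \<mu>)\<in>\<F>. s (X, H, \<mu>) * indicator H \<omega> * (X \<omega> - \<mu>))"

text \<open>
  The notion is meant for members \<open>(X, H, \<mu>)\<close> with \<open>H \<noteq> {}\<close> and \<open>X\<close> taking finitely many
  values on \<open>H\<close>; then the gain takes finitely many values, so that \<open>Min\<close> and \<open>Max\<close> are
  genuine extrema.
\<close>

definition coherent :: "'a assessed set \<Rightarrow> bool" where
  "coherent \<A> \<longleftrightarrow>
     (\<forall>\<F> s. \<F> \<subseteq> \<A> \<and> finite \<F> \<and> \<F> \<noteq> {} \<longrightarrow>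
        (let B = (\<Union>(X, H, \<mu>)\<in>\<F>. H)
         in Min (gain s \<F> ` B) \<le> 0 \<and> 0 \<le> Max (gain s \<F> ` B)))"

text \<open>
  The recursion in the definition of the conjunctions only passes through the assessed previsions
  of the smaller conjunctions, which are supplied by the parameter \<open>x\<close>.
\<close>

definition conj_quantity ::
  "('i \<Rightarrow> 'a set) \<Rightarrow> ('i \<Rightarrow> 'a set) \<Rightarrow> ('i set \<Rightarrow> real) \<Rightarrow> 'i set \<Rightarrow> 'a \<Rightarrow> real" where
  "conj_quantity A K x S \<omega> =
     indicator (\<Inter>i\<in>S. A i \<inter> K i) \<omega> +
     (\<Sum>R | R \<noteq> {} \<and> R \<subset> S.
        x R * indicator ((\<Inter>i\<in>R. - K i) \<inter> (\<Inter>i\<in>S - R. A i \<inter> K i)) \<omega>)"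

definition conj_event :: "('i \<Rightarrow> 'a set) \<Rightarrow> 'i set \<Rightarrow> 'a set" where
  "conj_event K S = (\<Union>i\<in>S. K i)"

text \<open>The empty conjunction is \<open>1\<close> by convention; \<open>x {}\<close> is never used.\<close>

definition conjunction ::
  "('i \<Rightarrow> 'a set) \<Rightarrow> ('i \<Rightarrow> 'a set) \<Rightarrow> ('i set \<Rightarrow> real) \<Rightarrow> 'i set \<Rightarrow> 'a \<Rightarrow> real" where
  "conjunction A K x S \<omega> =
     (if S = {} then 1 else cond_rq (conj_quantity A K x S) (conj_event K S) (x S) \<omega>)"

text \<open>
  The conditional constituent in which the conditional events with index in \<open>I\<close> are affirmed and
  the remaining ones negated, expressed through the conjunctions by inclusion-exclusion.
\<close>

definition constituent ::
  "nat \<Rightarrow> (nat \<Rightarrow> 'a set) \<Rightarrow> (nat \<Rightarrow> 'a set) \<Rightarrow> (nat set \<Rightarrow> real) \<Rightarrow> nat set \<Rightarrow> 'a \<Rightarrow> real" where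
  "constituent n E H x I \<omega> =
     (\<Sum>J | J \<subseteq> {1..n} - I. (- 1) ^ card J * conjunction E H x (I \<union> J) \<omega>)"

definition assessed_conjunctions ::
  "nat \<Rightarrow> (nat \<Rightarrow> 'a set) \<Rightarrow> (nat \<Rightarrow> 'a set) \<Rightarrow> (nat set \<Rightarrow> real) \<Rightarrow> 'a assessed set" where
  "assessed_conjunctions n E H x =
     {(conj_quantity E H x S, conj_event H S, x S) | S. S \<noteq> {} \<and> S \<subseteq> {1..n}}"

text \<open>
  The previsions \<open>x\<close> of the conjunctions enter the values of the constituents; \<open>p I\<close> is the
  prevision assessed for the constituent of \<open>I\<close>. Values of a constituent outside the conditioning
  event do not enter the gain.
\<close>

definition assessed_constituents ::
  "nat \<Rightarrow> (nat \<Rightarrow> 'a set) \<Rightarrow> (nat \<Rightarrow> 'a set) \<Rightarrow> (nat set \<Rightarrow> real) \<Rightarrow> (nat set \<Rightarrow> real)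
     \<Rightarrow> 'a assessed set" where
  "assessed_constituents n E H x p =
     {(constituent n E H x I, conj_event H {1..n}, p I) | I. I \<subseteq> {1..n}}"

text \<open>Vectors indexed by the subsets of \<open>{1..n}\<close> are extensional functions.\<close>

definition std_simplex :: "nat \<Rightarrow> (nat set \<Rightarrow> real) set" where
  "std_simplex n = {v \<in> Pow {1..n} \<rightarrow>\<^sub>E {0..}. (\<Sum>I\<in>Pow {1..n}. v I) = 1}"

end

theory Submission
  imports Defs
begin

text \<open>
  Write \<open>N = {1..n}\<close> and let \<open>m\<close> be \<open>M\<close> extended by \<open>m {} = 1\<close>. At a point \<open>\<omega>\<close> where some
  member of \<open>S\<close> is false, the conjunction of \<open>S\<close> has the value \<open>0\<close>; otherwise it has the value
  \<open>m (S \<inter> Z)\<close>, where \<open>Z\<close> is the set of indices that are void at \<open>\<omega>\<close> (\<open>conjunction_value\<close>). Since the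
  members of \<open>V - W\<close> enter with alternating signs, the alternating sum of conjunctions that
  affirms \<open>W\<close> and negates \<open>V - W\<close> is either \<open>0\<close> or the same alternating sum of \<open>m\<close>, formed on
  \<open>V \<inter> Z\<close> and \<open>W \<inter> Z\<close> (\<open>moebius_conjunction\<close>). Both directions rest on this formula.

  If \<open>v\<close> is a point of the simplex, independence supplies for each \<open>I \<subseteq> N\<close> a point at which nothing
  is void and exactly the members of \<open>I\<close> are true. Give it the weight \<open>v I\<close>. This is a probability
  on the conditioning event of any finite subfamily, and the expected value of each
  conjunction or constituent is its assessed prevision. Every gain therefore has expectation \<open>0\<close>, so it
  cannot be of one strict sign.

  Conversely, a coherent assessment is linear: betting on a constituent against the conjunctions
  that compose it gives a constant gain, hence \<open>P I\<close> is the alternating sum of \<open>m\<close> at \<open>N\<close> and \<open>I\<close>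
  (\<open>coherent_constituent_prevision\<close>). Moebius inversion (\<open>sum_moebius\<close>) turns this into
  the formula for \<open>M S\<close> and, at \<open>S = {}\<close>, shows that the previsions \<open>P I\<close> add up to \<open>1\<close>. It
  remains to see that the alternating sums of \<open>m\<close> are nonnegative (\<open>coherent_moebius_nonneg\<close>). One bets on the conjunctions that make up the sum for
  \<open>W \<subseteq> V\<close>. The bet is in force only where some member of \<open>V\<close> is not void, and there the quantity bet on is \<open>0\<close>
  or an alternating sum on a proper subset of \<open>V\<close>, so that induction on \<open>V\<close> applies.
\<close>

section \<open>Alternating sums over finite sets\<close>

text \<open>
  If \<open>c S\<close> is the prevision that all events in \<open>S\<close> occur, this is the inclusion-exclusion value of
  the prevision that those in \<open>W\<close> occur and those in \<open>V - W\<close> do not. The set \<open>W\<close> may stick out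
  of \<open>V\<close>, so that the recursion below can pair \<open>V\<close> with \<open>insert i W\<close> where \<open>i \<notin> V\<close>.
\<close>

definition moebius :: "('i set \<Rightarrow> real) \<Rightarrow> 'i set \<Rightarrow> 'i set \<Rightarrow> real" where
  "moebius c V W = (\<Sum>J | J \<subseteq> V - W. (- 1) ^ card J * c (W \<union> J))"

lemma moebius_self [simp]: "moebius c V V = c V"
  by (simp add: moebius_def)

lemma moebius_diff:
  "moebius (\<lambda>S. c S - d S) V W = moebius c V W - moebius d V W"
  by (simp add: moebius_def right_diff_distrib sum_subtractf)

lemma moebius_insert_both:
  assumes "i \<notin> V"
  shows "moebius c (insert i V) (insert i W) = moebius c V (insert i W)"
proof -
  have "insert i V - insert i W = V - insert i W" by blast
  then show ?thesis by (simp only: moebius_def)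
qed

text \<open>Splitting the subsets \<open>J\<close> according to whether they contain \<open>i\<close>.\<close>

lemma moebius_insert:
  assumes "finite V" "i \<notin> V" "i \<notin> W"
  shows "moebius c (insert i V) W = moebius c V W - moebius c V (insert i W)"
proof -
  let ?A = "{J. J \<subseteq> V - W}"
  have fin: "finite ?A" using assms by simp
  have eq: "{J. J \<subseteq> insert i V - W} = ?A \<union> insert i ` ?A"
    using assms Pow_insert[of i "V - W"] by (auto simp: Pow_def insert_Diff_if)
  have disj: "?A \<inter> insert i ` ?A = {}" using assms by auto
  have inj: "inj_on (insert i) ?A"
    using assms by (intro inj_onI) (metis Diff_iff insert_ident mem_Collect_eq subset_iff)
  have "(\<Sum>J\<in>insert i ` ?A. (- 1) ^ card J * c (W \<union> J))
      = (\<Sum>J\<in>?A. - ((- 1) ^ card J * c (insert i W \<union> J)))"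
    unfolding sum.reindex[OF inj]
  proof (rule sum.cong[OF refl])
    fix J assume J: "J \<in> ?A"
    then have "finite J" "i \<notin> J" using assms by (auto intro: finite_subset)
    then show "((\<lambda>J. (- 1) ^ card J * c (W \<union> J)) \<circ> insert i) J
        = - ((- 1) ^ card J * c (insert i W \<union> J))" by simp
  qed
  moreover have "V - insert i W = V - W" using assms by blast
  ultimately show ?thesis
    unfolding moebius_def eq by (simp add: sum.union_disjoint[OF fin _ disj] fin sum_negf)
qed

text \<open>
  Moebius inversion. Each further index \<open>i\<close> is summed out, since the terms for \<open>W\<close> and \<open>insert i W\<close> add
  up to the term without \<open>i\<close>.
\<close>

lemma sum_moebius:
  assumes "finite V" "S \<subseteq> V"
  shows "(\<Sum>W | S \<subseteq> W \<and> W \<subseteq> V. moebius c V W) = c S"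
proof -
  have "finite D \<Longrightarrow> D \<inter> S = {} \<Longrightarrow> (\<Sum>W | S \<subseteq> W \<and> W \<subseteq> D \<union> S. moebius c (D \<union> S) W) = c S" for D
  proof (induction D rule: finite_induct)
    case empty
    have "{W. S \<subseteq> W \<and> W \<subseteq> {} \<union> S} = {S}" by auto
    then show ?case by simp
  next
    case (insert i D)
    let ?V = "D \<union> S"
    let ?A = "{W. S \<subseteq> W \<and> W \<subseteq> ?V}"
    have V: "finite ?V" "i \<notin> ?V"
      using insert assms finite_subset by auto
    have fin: "finite ?A" using V by (auto intro: finite_subset[of _ "Pow ?V"])
    have eq: "{W. S \<subseteq> W \<and> W \<subseteq> insert i D \<union> S} = ?A \<union> insert i ` ?A"
    proof (intro set_eqI iffI)
      fix W assume W: "W \<in> {W. S \<subseteq> W \<and> W \<subseteq> insert i D \<union> S}"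
      show "W \<in> ?A \<union> insert i ` ?A"
      proof (cases "i \<in> W")
        case True
        then have "W = insert i (W - {i})" by auto
        moreover have "W - {i} \<in> ?A" using W V by auto
        ultimately show ?thesis by blast
      qed (use W in auto)
    qed auto
    have disj: "?A \<inter> insert i ` ?A = {}" using V by auto
    have inj: "inj_on (insert i) ?A"
      using V by (intro inj_onI) (metis insert_ident mem_Collect_eq subset_iff)
    have "(\<Sum>W | S \<subseteq> W \<and> W \<subseteq> insert i D \<union> S. moebius c (insert i D \<union> S) W)
        = (\<Sum>W\<in>?A. moebius c (insert i ?V) W) + (\<Sum>W\<in>?A. moebius c (insert i ?V) (insert i W))"
      unfolding eq by (simp add: sum.union_disjoint[OF fin _ disj] fin sum.reindex[OF inj])
    also have "\<dots> = (\<Sum>W\<in>?A. moebius c (insert i ?V) W + moebius c (insert i ?V) (insert i W))"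
      by (simp add: sum.distrib)
    also have "\<dots> = (\<Sum>W\<in>?A. moebius c ?V W)"
    proof (rule sum.cong[OF refl])
      fix W assume "W \<in> ?A"
      then have "i \<notin> W" using V by auto
      then show "moebius c (insert i ?V) W + moebius c (insert i ?V) (insert i W) = moebius c ?V W"
        by (simp add: moebius_insert[OF V] moebius_insert_both[OF V(2)])
    qed
    finally show ?case using insert by auto
  qed
  moreover have "(V - S) \<inter> S = {}" "(V - S) \<union> S = V" using assms by auto
  ultimately show ?thesis using assms by (metis finite_Diff)
qed

section \<open>Values of conjunctions and constituents\<close>

definition ext_prev :: "('i set \<Rightarrow> real) \<Rightarrow> 'i set \<Rightarrow> real" where
  "ext_prev x S = (if S = {} then 1 else x S)"

lemma conjunction_value:
  assumes "finite S"
  shows "conjunction A K x S \<omega> =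
    (if \<exists>i\<in>S. \<omega> \<in> K i - A i then 0 else ext_prev x (S \<inter> {i. \<omega> \<notin> K i}))"
proof (cases "S = {} \<or> (\<forall>i\<in>S. \<omega> \<notin> K i)")
  case True
  then have "S \<inter> {i. \<omega> \<notin> K i} = S" by auto
  then show ?thesis
    using True by (auto simp: conjunction_def ext_prev_def cond_rq_def conj_event_def)
next
  case False
  let ?Z = "S \<inter> {i. \<omega> \<notin> K i}"
  let ?R = "{R. R \<noteq> {} \<and> R \<subset> S}"
  have fin: "finite ?R" using assms by (auto intro: finite_subset[of _ "Pow S"])
  have "conjunction A K x S \<omega> = conj_quantity A K x S \<omega>"
    using False by (auto simp: conjunction_def cond_rq_def conj_event_def)
  also have "\<dots> = (if \<exists>i\<in>S. \<omega> \<in> K i - A i then 0 else ext_prev x ?Z)"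
  proof (cases "\<exists>i\<in>S. \<omega> \<in> K i - A i")
    case True
    then obtain i where i: "i \<in> S" "\<omega> \<in> K i" "\<omega> \<notin> A i" by blast
    have "\<omega> \<notin> (\<Inter>i\<in>R. - K i) \<inter> (\<Inter>i\<in>S - R. A i \<inter> K i)" for R
      using i by blast
    moreover have "\<omega> \<notin> (\<Inter>i\<in>S. A i \<inter> K i)" using i by blast
    ultimately show ?thesis using True by (simp add: conj_quantity_def)
  next
    case nofalse: False
    \<comment> \<open>Only the term of the set of void members survives.\<close>
    have "\<omega> \<in> (\<Inter>i\<in>R. - K i) \<inter> (\<Inter>i\<in>S - R. A i \<inter> K i) \<longleftrightarrow> R = ?Z" if "R \<in> ?R" for R
      using that nofalse by blast
    then have "(\<Sum>R\<in>?R. x R * indicator ((\<Inter>i\<in>R. - K i) \<inter> (\<Inter>i\<in>S - R. A i \<inter> K i)) \<omega>)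
        = (\<Sum>R\<in>?R. if R = ?Z then x R else 0)"
      by (intro sum.cong) (auto simp: indicator_def)
    also have "\<dots> = (if ?Z \<noteq> {} then x ?Z else 0)"
      using False by (subst sum.delta[OF fin]) auto
    finally have "conj_quantity A K x S \<omega>
        = indicator (\<Inter>i\<in>S. A i \<inter> K i) \<omega> + (if ?Z \<noteq> {} then x ?Z else 0)"
      by (simp add: conj_quantity_def)
    moreover have "\<omega> \<in> (\<Inter>i\<in>S. A i \<inter> K i) \<longleftrightarrow> ?Z = {}"
      using nofalse by blast
    ultimately show ?thesis
      unfolding if_not_P[OF nofalse] ext_prev_def by (simp add: indicator_def)
  qed
  finally show ?thesis .
qed

text \<open>
  A false index in \<open>W\<close> annihilates every term. A true index outside \<open>W\<close> does not change the value of a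
  conjunction, so the terms with and without it cancel. Otherwise the indices in \<open>V - W\<close>
  are false or void, and only the void ones contribute.
\<close>

lemma moebius_conjunction:
  assumes "finite V" "W \<subseteq> V"
  shows "moebius (\<lambda>S. conjunction A K x S \<omega>) V W =
    (if (\<exists>i\<in>W. \<omega> \<in> K i - A i) \<or> (\<exists>i\<in>V - W. \<omega> \<in> A i \<inter> K i) then 0
     else moebius (ext_prev x) (V \<inter> {i. \<omega> \<notin> K i}) (W \<inter> {i. \<omega> \<notin> K i}))"
proof -
  let ?C = "\<lambda>S. conjunction A K x S \<omega>"
  let ?Z = "{i. \<omega> \<notin> K i}"
  have finW: "finite W" using assms finite_subset by blast
  have finJ: "finite J" if "J \<subseteq> V - U" for J U
    using that assms finite_subset by blast
  consider (false) "\<exists>i\<in>W. \<omega> \<in> K i - A i" | (true) "\<exists>i\<in>V - W. \<omega> \<in> A i \<inter> K i"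
    | (other) "\<not> (\<exists>i\<in>W. \<omega> \<in> K i - A i)" "\<not> (\<exists>i\<in>V - W. \<omega> \<in> A i \<inter> K i)" by blast
  then show ?thesis
  proof cases
    case false
    then have "?C (W \<union> J) = 0" if "J \<subseteq> V - W" for J
      using finJ[OF that] finW by (subst conjunction_value) auto
    then show ?thesis using false by (simp add: moebius_def)
  next
    case true
    then obtain i where i: "i \<in> V" "i \<notin> W" "\<omega> \<in> A i" "\<omega> \<in> K i" by blast
    have "?C (insert i S) = ?C S" if "finite S" for S
    proof -
      have "insert i S \<inter> ?Z = S \<inter> ?Z" using i by blast
      moreover have "(\<exists>j\<in>insert i S. \<omega> \<in> K j - A j) \<longleftrightarrow> (\<exists>j\<in>S. \<omega> \<in> K j - A j)"
        using i by blast
      ultimately show ?thesis using that by (simp only: conjunction_value finite_insert)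
    qed
    then have "?C (insert i W \<union> J) = ?C (W \<union> J)" if "J \<subseteq> V - {i} - W" for J
      using that finW assms(1) finite_subset[of J V] by auto
    moreover have "V - {i} - insert i W = V - {i} - W" by blast
    ultimately have "moebius ?C (V - {i}) (insert i W) = moebius ?C (V - {i}) W"
      unfolding moebius_def by (intro sum.cong) auto
    moreover have "moebius ?C V W = moebius ?C (V - {i}) W - moebius ?C (V - {i}) (insert i W)"
      using moebius_insert[of "V - {i}" i W ?C] i assms by (simp add: insert_absorb)
    ultimately show ?thesis using true by simp
  next
    case other
    have "moebius ?C V W = (\<Sum>J | J \<subseteq> (V - W) \<inter> ?Z. (- 1) ^ card J * ?C (W \<union> J))"
      unfolding moebius_def
    proof (rule sum.mono_neutral_right)
      show "finite {J. J \<subseteq> V - W}" using assms by simp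
      show "\<forall>J\<in>{J. J \<subseteq> V - W} - {J. J \<subseteq> (V - W) \<inter> ?Z}. (- 1) ^ card J * ?C (W \<union> J) = 0"
      proof
        fix J assume J: "J \<in> {J. J \<subseteq> V - W} - {J. J \<subseteq> (V - W) \<inter> ?Z}"
        then have "\<exists>i\<in>W \<union> J. \<omega> \<in> K i - A i" using other by blast
        moreover have "finite (W \<union> J)" using J finJ finW by blast
        ultimately show "(- 1) ^ card J * ?C (W \<union> J) = 0"
          by (simp only: conjunction_value if_True mult_zero_right)
      qed
    qed auto
    also have "\<dots> = (\<Sum>J | J \<subseteq> (V - W) \<inter> ?Z. (- 1) ^ card J * ext_prev x ((W \<inter> ?Z) \<union> J))"
    proof (rule sum.cong[OF refl])
      fix J assume J: "J \<in> {J. J \<subseteq> (V - W) \<inter> ?Z}"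
      then have "finite (W \<union> J)" using finJ finW by blast
      moreover have "\<not> (\<exists>i\<in>W \<union> J. \<omega> \<in> K i - A i)" using other J by blast
      moreover have "(W \<union> J) \<inter> ?Z = (W \<inter> ?Z) \<union> J" using J by blast
      ultimately show "(- 1) ^ card J * ?C (W \<union> J)
          = (- 1) ^ card J * ext_prev x ((W \<inter> ?Z) \<union> J)"
        by (simp only: conjunction_value if_False)
    qed
    also have "(V - W) \<inter> ?Z = (V \<inter> ?Z) - (W \<inter> ?Z)" by blast
    finally show ?thesis using other unfolding moebius_def by auto
  qed
qed

lemma constituent_eq_moebius:
  "constituent n E H x I \<omega> = moebius (\<lambda>S. conjunction E H x S \<omega>) {1..n} I"
  by (simp add: constituent_def moebius_def)

text \<open>
  The amount won per unit stake on a conjunction is its value minus its prevision everywhere, and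
  not only on its conditioning event. Since both are \<open>1\<close> for the empty conjunction, this conjunction can be
  added to a bet at will.
\<close>

lemma conjunction_unit_gain:
  assumes "S \<noteq> {}"
  shows "indicator (conj_event K S) \<omega> * (conj_quantity A K x S \<omega> - x S)
    = conjunction A K x S \<omega> - ext_prev x S"
  using assms by (auto simp: conjunction_def ext_prev_def cond_rq_def indicator_def)

lemma sum_conjunction_unit_gains:
  assumes "finite V"
  shows "(\<Sum>J | J \<subseteq> V - W \<and> W \<union> J \<noteq> {}. (- 1) ^ card J *
      indicator (conj_event K (W \<union> J)) \<omega> * (conj_quantity A K x (W \<union> J) \<omega> - x (W \<union> J)))
    = moebius (\<lambda>S. conjunction A K x S \<omega>) V W - moebius (ext_prev x) V W" (is "?L = _")
proof -
  have "?L = (\<Sum>J | J \<subseteq> V - W \<and> W \<union> J \<noteq> {}.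
      (- 1) ^ card J * (conjunction A K x (W \<union> J) \<omega> - ext_prev x (W \<union> J)))"
    unfolding mult.assoc
    by (intro sum.cong refl arg_cong2[where f = "(*)"] conjunction_unit_gain) blast
  also have "\<dots> = (\<Sum>J | J \<subseteq> V - W.
      (- 1) ^ card J * (conjunction A K x (W \<union> J) \<omega> - ext_prev x (W \<union> J)))"
    using assms by (intro sum.mono_neutral_left) (auto simp: conjunction_def ext_prev_def)
  finally show ?thesis by (simp add: moebius_diff[symmetric] moebius_def[of "\<lambda>S. _ S - _ S"])
qed

section \<open>Gains\<close>

text \<open>
  Conjunctions and constituents are built from indicators by finitely many operations, so gains have
  finitely many values and the extrema in the definition of coherence are attained.
\<close>

lemma finite_range_binary:
  assumes "finite (range f)" "finite (range g)"
  shows "finite (range (\<lambda>\<omega>. h (f \<omega>) (g \<omega>)))"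
  by (rule finite_subset[of _ "case_prod h ` (range f \<times> range g)"]) (use assms in auto)

lemma finite_range_sum:
  fixes f :: "'b \<Rightarrow> 'a \<Rightarrow> real"
  assumes "\<And>j. j \<in> J \<Longrightarrow> finite (range (f j))"
  shows "finite (range (\<lambda>\<omega>. \<Sum>j\<in>J. f j \<omega>))"
  using assms
  by (induction J rule: infinite_finite_induct) (auto intro: finite_range_binary[of _ _ "(+)"])

lemma finite_range_indicator: "finite (range (indicator B :: 'a \<Rightarrow> real))"
  by (rule finite_subset[of _ "{0, 1}"]) (auto simp: indicator_def)

lemma finite_range_conj_quantity: "finite (range (conj_quantity A K x S))"
  unfolding conj_quantity_def
  by (intro finite_range_binary[of _ _ "(+)"] finite_range_sum finite_range_indicator
      finite_range_binary[of "\<lambda>_. x _" _ "(*)"]) simp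

lemma finite_range_conjunction: "finite (range (conjunction A K x S))"
  unfolding conjunction_def cond_rq_def
  by (cases "S = {}")
    (simp_all add: finite_range_binary[of _ _ "(+)"] finite_range_binary[of _ _ "(*)"]
      finite_range_conj_quantity finite_range_indicator)

lemma finite_range_constituent: "finite (range (constituent n E H x I))"
  unfolding constituent_def
  by (intro finite_range_sum finite_range_binary[of "\<lambda>_. (- 1) ^ card _" _ "(*)"]
      finite_range_conjunction) simp

lemma finite_range_assessed:
  assumes "(X, K, \<mu>) \<in> assessed_conjunctions n E H x \<union> assessed_constituents n E H x p"
  shows "finite (range X)"
  using assms finite_range_conj_quantity finite_range_constituent
  by (auto simp: assessed_conjunctions_def assessed_constituents_def)

lemma finite_range_gain:
  assumes "\<And>X K \<mu>. (X, K, \<mu>) \<in> \<F> \<Longrightarrow> finite (range X)"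
  shows "finite (range (gain s \<F>))"
proof -
  have "finite (range (\<lambda>\<omega>. s (X, K, \<mu>) * indicator K \<omega> * (X \<omega> - \<mu>)))"
    if "(X, K, \<mu>) \<in> \<F>" for X K \<mu>
    by (rule finite_range_binary[of _ _ "\<lambda>a b. s (X, K, \<mu>) * a * (b - \<mu>)"])
      (use assms[OF that] in \<open>auto intro: finite_range_indicator\<close>)
  then show ?thesis unfolding gain_def by (intro finite_range_sum) auto
qed

text \<open>
  Bets may be placed on an indexed family in which the same assessed quantity occurs several times:
  its stakes are added. This makes it irrelevant whether a constituent coincides, as an assessed
  quantity, with one of the conjunctions.
\<close>

lemma coherent_indexed_gain:
  fixes X :: "'b \<Rightarrow> 'a \<Rightarrow> real" and c :: "'b \<Rightarrow> real"
  assumes "coherent \<A>" "finite J"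
    and mem: "\<And>j. j \<in> J \<Longrightarrow> (X j, K j, \<mu> j) \<in> \<A>"
    and fin: "\<And>j. j \<in> J \<Longrightarrow> finite (range (X j))"
    and ne: "(\<Union>j\<in>J. K j) \<noteq> {}"
  defines "G \<equiv> \<lambda>\<omega>. \<Sum>j\<in>J. c j * indicator (K j) \<omega> * (X j \<omega> - \<mu> j)"
  shows "\<exists>\<omega>\<in>\<Union>j\<in>J. K j. G \<omega> \<le> 0" and "\<exists>\<omega>\<in>\<Union>j\<in>J. K j. 0 \<le> G \<omega>"
proof -
  let ?f = "\<lambda>j. (X j, K j, \<mu> j)"
  let ?B = "\<Union>j\<in>J. K j"
  define s where "s t = (\<Sum>j | j \<in> J \<and> ?f j = t. c j)" for t
  have gain: "gain s (?f ` J) = G"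
  proof
    fix \<omega> :: 'a
    let ?g = "\<lambda>(X, K, \<mu>). indicator K \<omega> * (X \<omega> - \<mu>)"
    have "G \<omega> = (\<Sum>j\<in>J. c j * ?g (?f j))"
      by (simp add: G_def mult.assoc)
    also have "\<dots> = (\<Sum>t\<in>?f ` J. \<Sum>j | j \<in> J \<and> ?f j = t. c j * ?g (?f j))"
      by (rule sum.image_gen[OF \<open>finite J\<close>])
    also have "\<dots> = (\<Sum>t\<in>?f ` J. s t * ?g t)"
      by (intro sum.cong refl) (auto simp: s_def sum_distrib_right intro!: sum.cong)
    also have "\<dots> = gain s (?f ` J) \<omega>"
      unfolding gain_def by (intro sum.cong refl) (auto simp: mult.assoc)
    finally show "gain s (?f ` J) \<omega> = G \<omega>" by simp
  qed
  have "finite (range (gain s (?f ` J)))"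
    using fin by (intro finite_range_gain) auto
  then have finB: "finite (G ` ?B)"
    unfolding gain by (rule finite_subset[rotated]) auto
  have "?f ` J \<subseteq> \<A>" "finite (?f ` J)" "?f ` J \<noteq> {}"
    using mem assms(2) ne by auto
  then have "Min (G ` ?B) \<le> 0 \<and> 0 \<le> Max (G ` ?B)"
    using assms(1)[unfolded coherent_def, rule_format, of "?f ` J" s]
    by (simp add: gain Let_def)
  moreover have "Min (G ` ?B) \<in> G ` ?B" "Max (G ` ?B) \<in> G ` ?B"
    using finB ne by (auto intro!: Min_in Max_in simp del: UN_simps)
  ultimately show "\<exists>\<omega>\<in>?B. G \<omega> \<le> 0" "\<exists>\<omega>\<in>?B. 0 \<le> G \<omega>"
    by (metis imageE)+
qed

text \<open>
  A probability of finite support on the common part of the conditioning events, under which each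
  quantity has its assessed prevision as expected value, makes every gain vanish in the mean.
\<close>

lemma coherent_if_expectation:
  fixes w :: "'b \<Rightarrow> real" and pt :: "'b \<Rightarrow> 'a"
  assumes w: "\<And>b. b \<in> Q \<Longrightarrow> 0 \<le> w b" "sum w Q = 1"
    and fin: "\<And>X K \<mu>. (X, K, \<mu>) \<in> \<A> \<Longrightarrow> finite (range X)"
    and pt: "\<And>X K \<mu> b. (X, K, \<mu>) \<in> \<A> \<Longrightarrow> b \<in> Q \<Longrightarrow> pt b \<in> K"
    and prev: "\<And>X K \<mu>. (X, K, \<mu>) \<in> \<A> \<Longrightarrow> (\<Sum>b\<in>Q. w b * X (pt b)) = \<mu>"
  shows "coherent \<A>"
  unfolding coherent_def Let_def
proof (intro allI impI)
  fix \<F> s assume F: "\<F> \<subseteq> \<A> \<and> finite \<F> \<and> \<F> \<noteq> {}"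
  let ?B = "\<Union>(X, K, \<mu>)\<in>\<F>. K"
  let ?G = "gain s \<F>"
  have finQ: "finite Q" by (rule ccontr) (use w(2) in simp)
  have term0: "(\<Sum>b\<in>Q. w b * (case t of (X, K, \<mu>) \<Rightarrow> s (X, K, \<mu>) * indicator K (pt b) * (X (pt b) - \<mu>))) = 0"
    if "t \<in> \<F>" for t
  proof (cases t)
    case (fields X K \<mu>)
    then have mem: "(X, K, \<mu>) \<in> \<A>" using that F by auto
    have "(\<Sum>b\<in>Q. w b * (s t * indicator K (pt b) * (X (pt b) - \<mu>)))
        = (\<Sum>b\<in>Q. s t * (w b * X (pt b) - w b * \<mu>))"
      using pt[OF mem] by (intro sum.cong refl) (simp add: algebra_simps)
    also have "\<dots> = s t * ((\<Sum>b\<in>Q. w b * X (pt b)) - sum w Q * \<mu>)"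
      by (simp add: sum_distrib_left sum_subtractf sum_distrib_right right_diff_distrib)
    also have "\<dots> = 0" using prev[OF mem] w by simp
    finally show ?thesis by (simp add: fields)
  qed
  have zero: "(\<Sum>b\<in>Q. w b * ?G (pt b)) = 0"
    unfolding gain_def sum_distrib_left by (subst sum.swap) (simp add: term0)
  \<comment> \<open>A strict sign of the gain on the support would persist in the mean, since some weight is positive.\<close>
  have nostrict: "\<exists>b\<in>Q. 0 \<le> \<sigma> * ?G (pt b)" for \<sigma>
  proof (rule ccontr)
    assume "\<not> ?thesis"
    then have neg: "\<sigma> * ?G (pt b) < 0" if "b \<in> Q" for b using that by force
    obtain b where b: "b \<in> Q" "w b \<noteq> 0" using w(2) by (metis sum.neutral zero_neq_one)
    have "(\<Sum>b\<in>Q. w b * (\<sigma> * ?G (pt b))) < (\<Sum>b\<in>Q. 0)"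
    proof (rule sum_strict_mono_ex1[OF finQ])
      show "\<forall>b\<in>Q. w b * (\<sigma> * ?G (pt b)) \<le> 0"
        using neg w(1) by (meson less_imp_le mult_nonneg_nonpos)
      have "w b * (\<sigma> * ?G (pt b)) < 0"
        using neg[OF b(1)] w(1)[OF b(1)] b(2) by (intro mult_pos_neg[of "w b"]) auto
      then show "\<exists>b\<in>Q. w b * (\<sigma> * ?G (pt b)) < 0" using b(1) by blast
    qed
    moreover have "(\<Sum>b\<in>Q. w b * (\<sigma> * ?G (pt b))) = \<sigma> * (\<Sum>b\<in>Q. w b * ?G (pt b))"
      by (simp add: sum_distrib_left mult.left_commute)
    ultimately show False using zero by simp
  qed
  have "finite (range ?G)" using F fin by (intro finite_range_gain) blast
  then have finB: "finite (?G ` ?B)" by (rule finite_subset[rotated]) auto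
  have inB: "pt b \<in> ?B" if "b \<in> Q" for b using F pt that by fastforce
  obtain a where a: "a \<in> Q" "0 \<le> 1 * ?G (pt a)" using nostrict by blast
  obtain b where b: "b \<in> Q" "0 \<le> - 1 * ?G (pt b)" using nostrict by blast
  have "Min (?G ` ?B) \<le> ?G (pt b)" using finB inB[OF b(1)] by (intro Min_le imageI)
  moreover have "?G (pt a) \<le> Max (?G ` ?B)" using finB inB[OF a(1)] by (intro Max_ge imageI)
  ultimately show "Min (?G ` ?B) \<le> 0 \<and> 0 \<le> Max (?G ` ?B)" using a b by linarith
qed

section \<open>Consequences of coherence\<close>

text \<open>
  Stake minus one unit on the constituent and the inclusion-exclusion signs on the conjunctions
  composing it: the random parts cancel, and a gain that is constant on its conditioning event
  must be \<open>0\<close>.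
\<close>

lemma coherent_constituent_prevision:
  assumes coh: "coherent (assessed_conjunctions n E H M \<union> assessed_constituents n E H M P)"
    and I: "I \<subseteq> {1..n}" and ne: "conj_event H {1..n} \<noteq> {}"
  shows "P I = moebius (ext_prev M) {1..n} I"
proof -
  let ?N = "{1..n}"
  define \<J> where "\<J> = {J. J \<subseteq> ?N - I \<and> I \<union> J \<noteq> {}}"
  let ?J = "insert None (Some ` \<J>)"
  let ?X = "case_option (constituent n E H M I) (\<lambda>J. conj_quantity E H M (I \<union> J))"
  let ?K = "case_option (conj_event H ?N) (\<lambda>J. conj_event H (I \<union> J))"
  let ?\<mu> = "case_option (P I) (\<lambda>J. M (I \<union> J))"
  let ?c = "case_option (- 1) (\<lambda>J. (- 1) ^ card J) :: nat set option \<Rightarrow> real"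
  let ?G = "\<lambda>\<omega>. \<Sum>j\<in>?J. ?c j * indicator (?K j) \<omega> * (?X j \<omega> - ?\<mu> j)"
  have fin: "finite \<J>" by (rule finite_subset[of _ "Pow ?N"]) (auto simp: \<J>_def)
  have mem: "(?X j, ?K j, ?\<mu> j) \<in> assessed_conjunctions n E H M \<union> assessed_constituents n E H M P"
    if "j \<in> ?J" for j
    using that I by (fastforce simp: \<J>_def assessed_conjunctions_def assessed_constituents_def)
  have U: "(\<Union>j\<in>?J. ?K j) = conj_event H ?N"
    using I by (fastforce simp: \<J>_def conj_event_def)
  have G: "?G \<omega> = P I - moebius (ext_prev M) ?N I" if "\<omega> \<in> conj_event H ?N" for \<omega>
  proof -
    have "?G \<omega> = - (constituent n E H M I \<omega> - P I) + (\<Sum>J\<in>\<J>. (- 1) ^ card J *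
        indicator (conj_event H (I \<union> J)) \<omega> * (conj_quantity E H M (I \<union> J) \<omega> - M (I \<union> J)))"
      using that fin by (simp add: sum.reindex)
    then show ?thesis
      unfolding \<J>_def
      by (simp only: sum_conjunction_unit_gains[OF finite_atLeastAtMost] constituent_eq_moebius)
  qed
  note bet = coherent_indexed_gain[of _ ?J ?X ?K ?\<mu> ?c, OF coh _ mem finite_range_assessed[OF mem],
      unfolded U, OF _ _ _ ne]
  have "\<exists>\<omega>\<in>conj_event H ?N. ?G \<omega> \<le> 0" "\<exists>\<omega>\<in>conj_event H ?N. 0 \<le> ?G \<omega>"
    using bet fin by blast+
  then show ?thesis using G by force
qed

text \<open>
  The bet on the alternating sum must fail to win at some point where a member of \<open>V\<close> is not void. At
  that point the quantity bet on is \<open>0\<close> or an alternating sum for a proper subset of \<open>V\<close>, which is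
  nonnegative by induction, and it is at most the price. Betting on the sum of the
  corresponding constituents would not do if \<open>V\<close> is a proper subset of \<open>{1..n}\<close>: that gain is in force
  and \<open>0\<close> where \<open>V\<close> is entirely void but some other index is not, which gives no information.
\<close>

lemma coherent_moebius_nonneg:
  assumes coh: "coherent (assessed_conjunctions n E H M \<union> \<A>)"
    and ne: "\<And>V. V \<noteq> {} \<Longrightarrow> V \<subseteq> {1..n} \<Longrightarrow> conj_event H V \<noteq> {}"
    and V: "V \<subseteq> {1..n}" and W: "W \<subseteq> V"
  shows "0 \<le> moebius (ext_prev M) V W"
proof -
  have "finite V" using V finite_subset by blast
  then show ?thesis using V W
  proof (induction V arbitrary: W rule: finite_psubset_induct)
    case (psubset V)
    show ?case
    proof (cases "V = {}")
      case True
      then show ?thesis using psubset.prems by (simp add: ext_prev_def)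
    next
      case False
      let ?J = "{J. J \<subseteq> V - W \<and> W \<union> J \<noteq> {}}"
      let ?X = "\<lambda>J. conj_quantity E H M (W \<union> J)"
      let ?K = "\<lambda>J. conj_event H (W \<union> J)"
      let ?q = "moebius (ext_prev M) V W"
      have fin: "finite ?J" using psubset.hyps by (auto intro: finite_subset[of _ "Pow V"])
      have U: "(\<Union>J\<in>?J. ?K J) = conj_event H V"
      proof
        show "(\<Union>J\<in>?J. ?K J) \<subseteq> conj_event H V"
          using psubset.prems unfolding conj_event_def by blast
        have eq: "W \<union> (V - W) = V" using psubset.prems by blast
        then have "V - W \<in> ?J" using False by simp
        then show "conj_event H V \<subseteq> (\<Union>J\<in>?J. ?K J)" by (rule UN_upper[of "V - W" _ ?K, unfolded eq])
      qed
      have mem: "(?X J, ?K J, M (W \<union> J)) \<in> assessed_conjunctions n E H M \<union> \<A>" if "J \<in> ?J" for J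
        using that psubset.prems unfolding assessed_conjunctions_def by blast
      have "\<exists>\<omega>\<in>conj_event H V.
          (\<Sum>J\<in>?J. (- 1) ^ card J * indicator (?K J) \<omega> * (?X J \<omega> - M (W \<union> J))) \<le> 0"
        using coherent_indexed_gain(1)[of _ ?J ?X ?K "\<lambda>J. M (W \<union> J)" "\<lambda>J. (- 1) ^ card J",
            OF coh fin mem finite_range_conj_quantity, unfolded U]
          ne[OF False] psubset.prems by blast
      then obtain \<omega> where \<omega>: "\<omega> \<in> conj_event H V"
        and le: "moebius (\<lambda>S. conjunction E H M S \<omega>) V W - ?q \<le> 0"
        unfolding sum_conjunction_unit_gains[OF psubset.hyps(1)] by blast
      have "V \<inter> {i. \<omega> \<notin> H i} \<subset> V" using \<omega> by (auto simp: conj_event_def)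
      then have "0 \<le> moebius (ext_prev M) (V \<inter> {i. \<omega> \<notin> H i}) (W \<inter> {i. \<omega> \<notin> H i})"
        using psubset.prems by (intro psubset.IH) auto
      then have "0 \<le> moebius (\<lambda>S. conjunction E H M S \<omega>) V W"
        using psubset by (simp add: moebius_conjunction)
      then show ?thesis using le by linarith
    qed
  qed
qed

section \<open>The characterization\<close>

lemma independent_true_point:
  assumes "logically_independent (N <+> N) (case_sum E H)" "I \<subseteq> N"
  shows "\<exists>\<omega>. \<forall>i\<in>N. \<omega> \<in> H i \<and> (\<omega> \<in> E i \<longleftrightarrow> i \<in> I)"
proof -
  let ?T = "I <+> N"
  have "?T \<subseteq> N <+> N" using assms(2) by auto
  then obtain \<omega> where "\<omega> \<in> (\<Inter>i\<in>?T. case_sum E H i) \<inter> (\<Inter>i\<in>(N <+> N) - ?T. - case_sum E H i)"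
    using assms(1) unfolding logically_independent_def by (meson ex_in_conv)
  then have "\<forall>i\<in>N. \<omega> \<in> H i \<and> (\<omega> \<in> E i \<longleftrightarrow> i \<in> I)"
    by fastforce
  then show ?thesis by blast
qed

theorem theorem16:
  fixes n :: nat
    and E H :: "nat \<Rightarrow> 'a set"
    and M P :: "nat set \<Rightarrow> real"
  assumes "n \<ge> 1"
    and "logically_independent ({1..n} <+> {1..n}) (case_sum E H)"
  shows "coherent (assessed_conjunctions n E H M \<union> assessed_constituents n E H M P) \<longleftrightarrow>
    (\<exists>v\<in>std_simplex n.
       (\<forall>I. I \<subseteq> {1..n} \<longrightarrow> P I = v I) \<and>
       (\<forall>S. S \<noteq> {} \<and> S \<subseteq> {1..n} \<longrightarrow> M S = (\<Sum>I | S \<subseteq> I \<and> I \<subseteq> {1..n}. v I)))"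
    (is "coherent ?A \<longleftrightarrow> ?R")
proof -
  let ?N = "{1..n}"
  obtain pt where pt: "\<And>I. I \<subseteq> ?N \<Longrightarrow> \<forall>i\<in>?N. pt I \<in> H i \<and> (pt I \<in> E i \<longleftrightarrow> i \<in> I)"
    using independent_true_point[OF assms(2)] by metis
  have ptK: "pt I \<in> conj_event H S" if S: "I \<subseteq> ?N" "S \<noteq> {}" "S \<subseteq> ?N" for I S
  proof -
    obtain i where i: "i \<in> S" using S(2) by blast
    then have "pt I \<in> H i" using pt[OF S(1)] S(3) by blast
    with i show ?thesis unfolding conj_event_def by blast
  qed
  show ?thesis
  proof
    assume coh: "coherent ?A"
    have ne: "conj_event H V \<noteq> {}" if "V \<noteq> {}" "V \<subseteq> ?N" for V
      using ptK[OF empty_subsetI that] by blast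
    have P: "P I = moebius (ext_prev M) ?N I" if "I \<subseteq> ?N" for I
      using assms(1) by (intro coherent_constituent_prevision[OF coh that] ne) auto
    have P0: "0 \<le> P I" if "I \<subseteq> ?N" for I
      unfolding P[OF that] by (rule coherent_moebius_nonneg[OF coh ne order_refl that])
    let ?v = "restrict P (Pow ?N)"
    have sumv: "(\<Sum>I | S \<subseteq> I \<and> I \<subseteq> ?N. ?v I) = ext_prev M S" if "S \<subseteq> ?N" for S
    proof -
      have "(\<Sum>I | S \<subseteq> I \<and> I \<subseteq> ?N. ?v I) = (\<Sum>I | S \<subseteq> I \<and> I \<subseteq> ?N. moebius (ext_prev M) ?N I)"
        by (intro sum.cong) (auto simp: P)
      then show ?thesis using that by (simp only: sum_moebius[OF finite_atLeastAtMost])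
    qed
    have "?v \<in> std_simplex n"
      using sumv[of "{}"] P0 by (simp add: std_simplex_def Pow_def ext_prev_def)
    moreover have "\<forall>I. I \<subseteq> ?N \<longrightarrow> P I = ?v I" by simp
    moreover have "\<forall>S. S \<noteq> {} \<and> S \<subseteq> ?N \<longrightarrow> M S = (\<Sum>I | S \<subseteq> I \<and> I \<subseteq> ?N. ?v I)"
      using sumv by (metis ext_prev_def)
    ultimately show ?R by blast
  next
    assume ?R
    then obtain v where v: "v \<in> std_simplex n" "\<forall>I. I \<subseteq> ?N \<longrightarrow> P I = v I"
      "\<forall>S. S \<noteq> {} \<and> S \<subseteq> ?N \<longrightarrow> M S = (\<Sum>I | S \<subseteq> I \<and> I \<subseteq> ?N. v I)"
      by (elim bexE conjE)
    \<comment> \<open>As nothing is void at \<open>pt I\<close>, only the value \<open>ext_prev M {} = 1\<close> can occur there besides \<open>0\<close>.\<close>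
    have noZ: "S \<inter> {i. pt I \<notin> H i} = {}" if "S \<subseteq> ?N" "I \<subseteq> ?N" for S I
      using that(1) pt[OF that(2)] by blast
    have C: "conjunction E H M S (pt I) = (if S \<subseteq> I then 1 else 0)" if "S \<subseteq> ?N" "I \<subseteq> ?N" for S I
    proof -
      have "(\<exists>i\<in>S. pt I \<in> H i - E i) \<longleftrightarrow> \<not> S \<subseteq> I"
        using that(1) pt[OF that(2)] by blast
      moreover have "finite S" using that finite_subset by blast
      ultimately show ?thesis
        by (simp add: conjunction_value noZ[OF that] ext_prev_def)
    qed
    have Kc: "constituent n E H M I' (pt I) = (if I = I' then 1 else 0)"
      if "I' \<subseteq> ?N" "I \<subseteq> ?N" for I I'
    proof -
      have "(\<exists>i\<in>I'. pt I \<in> H i - E i) \<or> (\<exists>i\<in>?N - I'. pt I \<in> E i \<inter> H i) \<longleftrightarrow> I \<noteq> I'"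
        using that pt[OF that(2)] by blast
      then show ?thesis unfolding constituent_eq_moebius
        by (simp only: moebius_conjunction[OF finite_atLeastAtMost that(1)] noZ[OF that]
            noZ[OF order_refl that(2)] moebius_self) (simp add: ext_prev_def)
    qed
    show "coherent ?A"
    proof (rule coherent_if_expectation[of "Pow ?N" v _ pt])
      show "0 \<le> v I" if "I \<in> Pow ?N" for I
        using v(1) that by (auto simp: std_simplex_def PiE_iff)
      show "sum v (Pow ?N) = 1" using v(1) by (simp add: std_simplex_def)
      show "finite (range X)" if "(X, K, \<mu>) \<in> ?A" for X K \<mu>
        using finite_range_assessed[OF that] .
      show "pt I \<in> K" if "(X, K, \<mu>) \<in> ?A" "I \<in> Pow ?N" for X K \<mu> I
        using that ptK assms(1) by (auto simp: assessed_conjunctions_def assessed_constituents_def)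
      show "(\<Sum>I\<in>Pow ?N. v I * X (pt I)) = \<mu>" if "(X, K, \<mu>) \<in> ?A" for X K \<mu>
        using that
      proof
        assume "(X, K, \<mu>) \<in> assessed_conjunctions n E H M"
        then obtain S where S: "S \<noteq> {}" "S \<subseteq> ?N" "X = conj_quantity E H M S" "\<mu> = M S"
          by (auto simp: assessed_conjunctions_def)
        have "X (pt I) = (if S \<subseteq> I then 1 else 0)" if "I \<subseteq> ?N" for I
          using ptK[OF that S(1,2)] C[OF S(2) that] S by (simp add: conjunction_def cond_rq_def)
        then have "(\<Sum>I\<in>Pow ?N. v I * X (pt I)) = (\<Sum>I\<in>Pow ?N. if S \<subseteq> I then v I else 0)"
          by (intro sum.cong) auto
        also have "\<dots> = (\<Sum>I | S \<subseteq> I \<and> I \<subseteq> ?N. v I)"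
          by (simp add: sum.inter_filter[symmetric] conj_commute)
        finally show ?thesis using v(3) S by simp
      next
        assume "(X, K, \<mu>) \<in> assessed_constituents n E H M P"
        then obtain I' where I': "I' \<subseteq> ?N" "X = constituent n E H M I'" "\<mu> = P I'"
          by (auto simp: assessed_constituents_def)
        have "(\<Sum>I\<in>Pow ?N. v I * X (pt I)) = (\<Sum>I\<in>Pow ?N. if I = I' then v I else 0)"
          using I' by (intro sum.cong) (auto simp: Kc)
        also have "\<dots> = v I'" using I' by simp
        finally show ?thesis using v(2) I' by simp
      qed
    qed
  qed
qed

end
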